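(* Let $S$ be a nonzero finite dimensional subspace of $H$ and $\mathbf{A_{S,E}}=\{P_SE_jP_S\}_{j=1}^\infty$. Then $$W(\mathbf{A_{S,E}})=\{t\,x:0\le t\le1,\ x\in m_S\}=\bigcup_{t\in[0,1]}\Big\{t\big(\operatorname{tr}(\mu P_SE_1P_S),\operatorname{tr}(\mu P_SE_2P_S),\dots\big):\mu\in\mathcal{D}_S\Big\},$$ and hence $\operatorname{cone}(W(\mathbf{A_{S,E}}))=\operatorname{cone}(m_S)$.
   Context: $H$ is a complex separable infinite dimensional Hilbert space with a fixed orthonormal basis $E=\{e_j\}_{j=1}^\infty$; $E_j=e_j\otimes e_j$ is the rank-one orthogonal projection onto $\mathrm{span}\{e_j\}$; $P_S$ is the orthogonal projection onto $S$; $\mathcal{B}_1(H)$ is the space of trace-class operators. $\mathcal{D}_S=\{Y\in\mathcal{B}_1(H):P_SY=Y\ge0,\ \operatorname{tr}(Y)=1\}$, and $m_S=\{(\langle Ye_j,e_j\rangle)_{j\in\mathbb{N}}:Y\in\mathcal{D}_S\}\subset\ell^1(\mathbb{R})$. The joint numerical range is $W(\mathbf{A_{S,E}})=\{\{\operatorname{tr}(P_SE_jP_S\rho)\}_{j=1}^\infty:\rho\in\mathcal{B}_1(H),\ \rho\ge0,\ \operatorname{tr}(\rho)=1\}$. For a set $X$, $\operatorname{cone}(X)=\{\lambda x:\lambda\ge0,\ x\in X\}$. *)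

theory Defs
  imports "HOL-Analysis.Analysis"
begin

text \<open>Complex Hilbert spaces. The inner product is linear in its first argument.\<close>

class complex_hilbert = banach +
  fixes scaleC :: "complex \<Rightarrow> 'a \<Rightarrow> 'a"
    and cinner :: "'a \<Rightarrow> 'a \<Rightarrow> complex"
  assumes scaleC_add_right: "scaleC a (x + y) = scaleC a x + scaleC a y"
    and scaleC_add_left: "scaleC (a + b) x = scaleC a x + scaleC b x"
    and scaleC_scaleC: "scaleC a (scaleC b x) = scaleC (a * b) x"
    and scaleC_one: "scaleC 1 x = x"
    and scaleR_scaleC: "scaleR r x = scaleC (complex_of_real r) x"
    and cinner_commute: "cinner x y = cnj (cinner y x)"
    and cinner_add_left: "cinner (x + y) z = cinner x z + cinner y z"
    and cinner_scaleC_left: "cinner (scaleC a x) y = a * cinner x y"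
    and cinner_ge_zero: "0 \<le> Re (cinner x x)"
    and norm_eq_sqrt_cinner: "norm x = sqrt (Re (cinner x x))"

global_interpretation complex_vector: vector_space "scaleC :: complex \<Rightarrow> 'a \<Rightarrow> 'a::complex_hilbert"
  defines csubspace = complex_vector.subspace
    and cspan = complex_vector.span
  by unfold_locales (simp_all add: scaleC_add_right scaleC_add_left scaleC_scaleC scaleC_one)

text \<open>The index type \<^typ>\<open>nat\<close> makes the space infinite dimensional, and totality of a
  countable family makes it separable.\<close>

definition orthonormal_basis :: "(nat \<Rightarrow> 'a::complex_hilbert) \<Rightarrow> bool" where
  "orthonormal_basis e \<longleftrightarrow>
     (\<forall>i j. cinner (e i) (e j) = (if i = j then 1 else 0)) \<and> closure (cspan (range e)) = UNIV"

definition finite_dim_subspace :: "'a::complex_hilbert set \<Rightarrow> bool" where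
  "finite_dim_subspace S \<longleftrightarrow> csubspace S \<and> (\<exists>B. finite B \<and> cspan B = S)"

definition bounded_clinear :: "('a::complex_hilbert \<Rightarrow> 'a) \<Rightarrow> bool" where
  "bounded_clinear T \<longleftrightarrow> bounded_linear T \<and> (\<forall>a x. T (scaleC a x) = scaleC a (T x))"

definition positive_op :: "('a::complex_hilbert \<Rightarrow> 'a) \<Rightarrow> bool" where
  "positive_op T \<longleftrightarrow> bounded_clinear T \<and> (\<forall>x. cinner (T x) x \<in> \<real> \<and> 0 \<le> Re (cinner (T x) x))"

definition cadjoint :: "('a::complex_hilbert \<Rightarrow> 'a) \<Rightarrow> 'a \<Rightarrow> 'a" where
  "cadjoint T = (THE T'. \<forall>x y. cinner (T x) y = cinner x (T' y))"

definition abs_op :: "('a::complex_hilbert \<Rightarrow> 'a) \<Rightarrow> 'a \<Rightarrow> 'a" where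
  "abs_op T = (THE R. positive_op R \<and> R \<circ> R = cadjoint T \<circ> T)"

text \<open>The trace class and the trace do not depend on the orthonormal basis \<open>e\<close> used to
  compute them.\<close>

definition trace_class :: "(nat \<Rightarrow> 'a::complex_hilbert) \<Rightarrow> ('a \<Rightarrow> 'a) \<Rightarrow> bool" where
  "trace_class e T \<longleftrightarrow> bounded_clinear T \<and> summable (\<lambda>n. cinner (abs_op T (e n)) (e n))"

definition op_trace :: "(nat \<Rightarrow> 'a::complex_hilbert) \<Rightarrow> ('a \<Rightarrow> 'a) \<Rightarrow> complex" where
  "op_trace e T = (\<Sum>n. cinner (T (e n)) (e n))"

definition rank_one :: "'a::complex_hilbert \<Rightarrow> 'a \<Rightarrow> 'a \<Rightarrow> 'a" where
  "rank_one f g = (\<lambda>x. scaleC (cinner x g) f)"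

definition proj :: "'a::complex_hilbert set \<Rightarrow> 'a \<Rightarrow> 'a" where
  "proj S x = (THE y. y \<in> S \<and> (\<forall>z\<in>S. cinner (x - y) z = 0))"

definition density_ops :: "(nat \<Rightarrow> 'a::complex_hilbert) \<Rightarrow> 'a set \<Rightarrow> ('a \<Rightarrow> 'a) set" where
  "density_ops e S = {Y. trace_class e Y \<and> proj S \<circ> Y = Y \<and> positive_op Y \<and> op_trace e Y = 1}"

text \<open>Sequences are kept complex-valued, so that no imaginary part is discarded by the
  definitions; the entries below are in fact real, and the sequences summable.\<close>

definition moment_set :: "(nat \<Rightarrow> 'a::complex_hilbert) \<Rightarrow> 'a set \<Rightarrow> (nat \<Rightarrow> complex) set" where
  "moment_set e S = {(\<lambda>j. cinner (Y (e j)) (e j)) | Y. Y \<in> density_ops e S}"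

lemma moment_set_nonneg_real:
  assumes "x \<in> moment_set e S"
  shows "x j \<in> \<real>" and "0 \<le> Re (x j)"
  using assms by (auto simp: moment_set_def density_ops_def positive_op_def)

definition joint_numerical_range ::
  "(nat \<Rightarrow> 'a::complex_hilbert) \<Rightarrow> (nat \<Rightarrow> 'a \<Rightarrow> 'a) \<Rightarrow> (nat \<Rightarrow> complex) set" where
  "joint_numerical_range e A =
     {(\<lambda>j. op_trace e (A j \<circ> \<rho>)) | \<rho>. trace_class e \<rho> \<and> positive_op \<rho> \<and> op_trace e \<rho> = 1}"

definition compressions :: "(nat \<Rightarrow> 'a::complex_hilbert) \<Rightarrow> 'a set \<Rightarrow> nat \<Rightarrow> 'a \<Rightarrow> 'a" where
  "compressions e S j = proj S \<circ> rank_one (e j) (e j) \<circ> proj S"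

definition cone_of :: "(nat \<Rightarrow> complex) set \<Rightarrow> (nat \<Rightarrow> complex) set" where
  "cone_of X = {(\<lambda>j. complex_of_real l * x j) | l x. 0 \<le> l \<and> x \<in> X}"

end

theory Submission
  imports Defs
begin

text \<open>
  Write \<open>P\<close> for \<open>proj S\<close> and \<open>Q = 1 - P\<close>. For a state \<open>\<rho>\<close>, Parseval's identity gives
  \<open>tr (P E\<^sub>j P \<rho>) = \<langle>\<rho> P e\<^sub>j, P e\<^sub>j\<rangle>\<close>, the \<open>j\<close>-th diagonal entry of \<open>P \<rho> P\<close>
  (\<open>op_trace_compression_left\<close>). So the joint numerical range consists of the diagonals of the
  operators \<open>P \<rho> P\<close>, which are positive and live on \<open>S\<close>.

  The trace \<open>t\<close> of \<open>P \<rho> P\<close> lies between 0 and 1 (\<open>trace_compression_le\<close>). If \<open>t > 0\<close>, then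
  \<open>P \<rho> P / t\<close> is a density operator on \<open>S\<close> and the diagonal is \<open>t\<close> times a point of the moment
  set. If \<open>t = 0\<close>, the diagonal is zero, and zero is \<open>0 \<cdot> x\<close> for any point \<open>x\<close> of the
  moment set, which is nonempty because \<open>S\<close> is nonzero.

  Conversely, given a density operator \<open>Y\<close> on \<open>S\<close> and \<open>t \<in> [0,1]\<close>, the missing weight is
  placed where \<open>P\<close> does not see it: for a unit vector \<open>g\<close> orthogonal to \<open>S\<close>, which exists since
  the space is infinite dimensional (\<open>unit_vector_orthogonal\<close>), the operator
  \<open>t Y + (1 - t) g \<otimes> g\<close> is a state whose compression is \<open>t Y\<close>.

  The trace bound is elementary because \<open>P\<close> has finite rank: expanding \<open>\<langle>\<rho> e\<^sub>n, e\<^sub>n\<rangle>\<close> along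
  \<open>e\<^sub>n = P e\<^sub>n + Q e\<^sub>n\<close>, the mixed terms sum to the trace of \<open>Q \<rho> P\<close>, which
  \<open>trace_restricted_to_range\<close> evaluates as \<open>\<Sum> \<langle>Q \<rho> f, f\<rangle> = 0\<close> over an orthonormal
  basis of \<open>S\<close>; the \<open>Q \<rho> Q\<close> terms that remain are nonnegative.

  One analytic fact remains. The trace class is described through the absolute value
  \<open>\<bar>T\<bar>\<close>, so diagonals of a positive \<open>T\<close> can be used only once \<open>\<bar>T\<bar> = T\<close> is known
  (\<open>abs_op_positive\<close>). This is the uniqueness of positive square roots, proved in
  \<open>positive_square_root_unique\<close> directly from the operator norm, without spectral theory.
\<close>

section \<open>Calculus of the complex inner product\<close>

lemma cinner_add_right: "cinner x (y + z) = cinner x y + cinner x z"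
  by (metis cinner_commute cinner_add_left complex_cnj_add)

lemma cinner_scaleC_right: "cinner x (scaleC a y) = cnj a * cinner x y"
  by (metis cinner_commute cinner_scaleC_left complex_cnj_mult)

lemma cinner_scaleR_left: "cinner (scaleR r x) y = complex_of_real r * cinner x y"
  by (simp add: scaleR_scaleC cinner_scaleC_left)

lemma cinner_scaleR_right: "cinner x (scaleR r y) = complex_of_real r * cinner x y"
  by (simp add: scaleR_scaleC cinner_scaleC_right)

lemma cinner_zero_left [simp]: "cinner 0 x = 0"
  using cinner_add_left[of 0 0 x] by simp

lemma cinner_zero_right [simp]: "cinner x 0 = 0"
  using cinner_add_right[of x 0 0] by simp

lemma cinner_minus_left: "cinner (- x) y = - cinner x y"
  using cinner_add_left[of x "- x" y] by (simp add: add_eq_0_iff)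

lemma cinner_minus_right: "cinner x (- y) = - cinner x y"
  using cinner_add_right[of x y "- y"] by (simp add: add_eq_0_iff)

lemma cinner_diff_left: "cinner (x - y) z = cinner x z - cinner y z"
  using cinner_add_left[of x "- y" z] by (simp add: cinner_minus_left)

lemma cinner_diff_right: "cinner x (y - z) = cinner x y - cinner x z"
  using cinner_add_right[of x y "- z"] by (simp add: cinner_minus_right)

lemma cinner_sum_left: "cinner (sum f A) y = (\<Sum>a\<in>A. cinner (f a) y)"
  by (induction A rule: infinite_finite_induct) (simp_all add: cinner_add_left)

lemmas cinner_linear = cinner_add_left cinner_add_right cinner_diff_left cinner_diff_right
  cinner_scaleC_left cinner_scaleC_right cinner_scaleR_left cinner_scaleR_right

lemma cinner_self: "cinner x x = complex_of_real ((norm x)\<^sup>2)"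
proof -
  have "Im (cinner x x) = 0"
    using arg_cong[OF cinner_commute[of x x], of Im] by simp
  then show ?thesis
    by (simp add: complex_eq_iff norm_eq_sqrt_cinner cinner_ge_zero)
qed

lemma Re_cinner_self: "Re (cinner x x) = (norm x)\<^sup>2"
  by (simp only: cinner_self Re_complex_of_real)

lemma norm_scaleC: "norm (scaleC a x) = cmod a * norm (x::'a::complex_hilbert)"
proof -
  have "complex_of_real ((norm (scaleC a x))\<^sup>2) = a * cnj a * cinner x x"
    by (simp only: cinner_self[symmetric] cinner_linear mult_ac)
  also have "\<dots> = complex_of_real ((cmod a * norm x)\<^sup>2)"
    by (simp only: cinner_self power_mult_distrib of_real_mult complex_norm_square)
  finally have "complex_of_real ((norm (scaleC a x))\<^sup>2) = complex_of_real ((cmod a * norm x)\<^sup>2)" .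
  then have "(norm (scaleC a x))\<^sup>2 = (cmod a * norm x)\<^sup>2"
    by (simp only: of_real_eq_iff)
  then show ?thesis by (simp add: power2_eq_iff_nonneg)
qed

lemma norm_diff_squared:
  "(norm (x - y))\<^sup>2 = (norm x)\<^sup>2 - 2 * Re (cinner x y) + (norm (y::'a::complex_hilbert))\<^sup>2"
proof -
  have "(norm (x - y))\<^sup>2 = Re (cinner (x - y) (x - y))"
    by (simp only: Re_cinner_self)
  also have "\<dots> = (norm x)\<^sup>2 - Re (cinner x y) - Re (cinner y x) + (norm y)\<^sup>2"
    by (simp add: cinner_linear Re_cinner_self)
  also have "Re (cinner y x) = Re (cinner x y)"
    by (subst cinner_commute) simp
  finally show ?thesis by simp
qed

text \<open>Subtracting from \<open>x\<close> its component along \<open>y\<close> leaves a vector of nonnegative squared norm.\<close>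

lemma cauchy_schwarz: "cmod (cinner x y) \<le> norm x * norm (y::'a::complex_hilbert)"
proof (cases "y = 0")
  case False
  define a where "a = cinner x y / complex_of_real ((norm y)\<^sup>2)"
  have ny: "(norm y)\<^sup>2 > 0" using False by simp
  have "0 \<le> (norm (x - scaleC a y))\<^sup>2" by simp
  also have "\<dots> = (norm x)\<^sup>2 - 2 * Re (cnj a * cinner x y) + (cmod a)\<^sup>2 * (norm y)\<^sup>2"
    by (simp add: norm_diff_squared cinner_linear norm_scaleC power_mult_distrib)
  also have "cnj a * cinner x y = complex_of_real ((cmod (cinner x y))\<^sup>2 / (norm y)\<^sup>2)"
    by (simp add: a_def complex_norm_square[symmetric] mult.commute flip: of_real_power)
  also have "(cmod a)\<^sup>2 * (norm y)\<^sup>2 = (cmod (cinner x y))\<^sup>2 / (norm y)\<^sup>2"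
    using ny by (simp only: a_def norm_divide norm_of_real power_divide) (simp add: power2_eq_square)
  finally have "(cmod (cinner x y))\<^sup>2 / (norm y)\<^sup>2 \<le> (norm x)\<^sup>2" by simp
  then have "(cmod (cinner x y))\<^sup>2 \<le> (norm x * norm y)\<^sup>2"
    using ny by (simp add: pos_divide_le_eq power_mult_distrib)
  then show ?thesis by (rule power2_le_imp_le) simp
qed simp

lemma bounded_linear_cinner_left: "bounded_linear (\<lambda>x::'a::complex_hilbert. cinner x y)"
  by (rule bounded_linear_intro[of _ "norm y"])
     (simp_all add: cinner_linear cauchy_schwarz scaleR_conv_of_real)

lemma bounded_linear_scaleC_left: "bounded_linear (\<lambda>a. scaleC a (x::'a::complex_hilbert))"
  by (rule bounded_linear_intro[of _ "norm x"])
     (simp_all add: scaleC_add_left scaleR_scaleC norm_scaleC scaleC_scaleC scaleR_conv_of_real)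

lemma cinner_ext:
  assumes "\<And>z. cinner x z = cinner y z"
  shows "x = (y::'a::complex_hilbert)"
proof -
  have "cinner (x - y) (x - y) = 0" by (simp add: assms cinner_diff_left)
  then show ?thesis by (simp add: cinner_self)
qed

section \<open>Finite orthonormal sets and projections\<close>

definition orthonormal_set :: "'a::complex_hilbert set \<Rightarrow> bool" where
  "orthonormal_set F \<longleftrightarrow> (\<forall>f\<in>F. \<forall>g\<in>F. cinner f g = (if f = g then 1 else 0))"

lemma bessel_residual_orthogonal:
  assumes "finite F" "orthonormal_set F" "z \<in> cspan F"
  shows "cinner (x - (\<Sum>f\<in>F. scaleC (cinner x f) f)) z = 0"
  using assms(3)
proof (induction rule: complex_vector.span_induct_alt)
  case base
  then show ?case by simp
next
  case (step c g y)
  have "(\<Sum>f\<in>F. cinner x f * cinner f g) = (\<Sum>f\<in>F. if f = g then cinner x f else 0)"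
    using assms step by (intro sum.cong) (auto simp: orthonormal_set_def)
  also have "\<dots> = cinner x g"
    using assms step by simp
  finally show ?case
    using step by (simp add: cinner_linear cinner_sum_left)
qed

lemma fourier_sum_in_span: "(\<Sum>f\<in>F. scaleC (a f) f) \<in> cspan F"
  by (intro complex_vector.span_sum complex_vector.span_scale complex_vector.span_base)

lemma proj_unique:
  assumes "csubspace S" "y \<in> S" "\<And>z. z \<in> S \<Longrightarrow> cinner (x - y) z = 0"
  shows "proj S x = y"
  unfolding proj_def
proof (rule the_equality)
  fix w assume w: "w \<in> S \<and> (\<forall>z\<in>S. cinner (x - w) z = 0)"
  then have "w - y \<in> S" using assms by (simp add: complex_vector.subspace_diff)
  then have "cinner (x - y) (w - y) - cinner (x - w) (w - y) = 0"
    using assms(3) w by simp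
  then have "cinner (w - y) (w - y) = 0" by (simp add: cinner_diff_left)
  then show "w = y" by (simp add: cinner_self)
qed (use assms in auto)

text \<open>The explicit Fourier sum turns the projection, given by a definite description, into an
  operator that visibly exists, is linear and is bounded.\<close>

lemma proj_cspan_orthonormal:
  assumes "finite F" "orthonormal_set F"
  shows "proj (cspan F) x = (\<Sum>f\<in>F. scaleC (cinner x f) f)"
  by (rule proj_unique) (simp_all add: fourier_sum_in_span bessel_residual_orthogonal assms)

text \<open>Gram--Schmidt: a new vector \<open>b\<close> either lies in the span already, or its normalized residual \<open>u\<close>
  extends the orthonormal set.\<close>

lemma orthonormal_set_spanning:
  assumes "finite B"
  obtains F where "finite F" "orthonormal_set F" "cspan F = cspan (B::'a::complex_hilbert set)"
proof -
  have "\<exists>F. finite F \<and> orthonormal_set F \<and> cspan F = cspan B"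
    using assms
  proof (induction B)
    case empty
    show ?case by (rule exI[of _ "{}"]) (simp add: orthonormal_set_def)
  next
    case (insert b B)
    then obtain F where F: "finite F" "orthonormal_set F" "cspan F = cspan B" by blast
    define p where "p = (\<Sum>f\<in>F. scaleC (cinner b f) f)"
    have p: "p \<in> cspan F" unfolding p_def by (rule fourier_sum_in_span)
    have orth: "cinner (b - p) z = 0" if "z \<in> cspan F" for z
      unfolding p_def using F that by (simp add: bessel_residual_orthogonal)
    show ?case
    proof (cases "b = p")
      case True
      then have "cspan (insert b B) = cspan B"
        using p F by (simp add: complex_vector.span_redundant)
      then show ?thesis using F by auto
    next
      case False
      define u where "u = scaleC (complex_of_real (1 / norm (b - p))) (b - p)"
      have n: "norm (b - p) \<noteq> 0" using False by simp
      have u1: "cinner u u = 1"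
        using n by (simp add: u_def cinner_self norm_scaleC norm_divide)
      have uF: "cinner u f = 0" "cinner f u = 0" if "f \<in> F" for f
      proof -
        show *: "cinner u f = 0"
          using orth[OF complex_vector.span_base[OF that]] by (simp add: u_def cinner_linear(5))
        show "cinner f u = 0" by (subst cinner_commute) (simp add: *)
      qed
      have b: "b = scaleC (complex_of_real (norm (b - p))) u + p"
        using n by (simp add: u_def scaleC_scaleC scaleC_one flip: of_real_mult)
      have sub1: "cspan (insert u F) \<subseteq> cspan (insert b B)"
      proof (rule complex_vector.span_minimal)
        have FB: "cspan F \<subseteq> cspan (insert b B)"
          unfolding F(3) by (rule complex_vector.span_mono) auto
        have "u \<in> cspan (insert b B)"
          unfolding u_def using p FB
          by (intro complex_vector.span_scale complex_vector.span_diff)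
             (auto intro: complex_vector.span_base)
        then show "insert u F \<subseteq> cspan (insert b B)"
          using FB complex_vector.span_superset[of F] by auto
      qed simp
      have sub2: "cspan (insert b B) \<subseteq> cspan (insert u F)"
      proof (rule complex_vector.span_minimal)
        have BF: "cspan F \<subseteq> cspan (insert u F)"
          by (rule complex_vector.span_mono) auto
        have "scaleC (complex_of_real (norm (b - p))) u + p \<in> cspan (insert u F)"
          using p BF by (intro complex_vector.span_add complex_vector.span_scale)
             (auto intro: complex_vector.span_base)
        then show "insert b B \<subseteq> cspan (insert u F)"
          using BF complex_vector.span_superset[of B] F(3) b by auto
      qed simp
      have "orthonormal_set (insert u F)"
        using F(2) u1 uF unfolding orthonormal_set_def by auto
      then show ?thesis using F(1) sub1 sub2 by (intro exI[of _ "insert u F"]) auto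
    qed
  qed
  then show ?thesis using that by blast
qed

lemma finite_dim_subspace_orthonormal:
  assumes "finite_dim_subspace S"
  obtains F where "finite F" "orthonormal_set F" "S = cspan F"
  using assms orthonormal_set_spanning unfolding finite_dim_subspace_def by metis

lemma proj_in:
  assumes "finite_dim_subspace S" shows "proj S x \<in> S"
proof -
  obtain F where "finite F" "orthonormal_set F" "S = cspan F"
    using finite_dim_subspace_orthonormal[OF assms] .
  then show ?thesis by (simp add: proj_cspan_orthonormal fourier_sum_in_span)
qed

lemma proj_residual_orthogonal:
  assumes "finite_dim_subspace S" "z \<in> S" shows "cinner (x - proj S x) z = 0"
proof -
  obtain F where "finite F" "orthonormal_set F" "S = cspan F"
    using finite_dim_subspace_orthonormal[OF assms(1)] .
  then show ?thesis
    using assms(2) by (simp add: proj_cspan_orthonormal bessel_residual_orthogonal)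
qed

lemma proj_fixes:
  assumes "finite_dim_subspace S" "x \<in> S" shows "proj S x = x"
  using assms by (intro proj_unique) (auto simp: finite_dim_subspace_def)

lemma proj_orthogonal_eq_zero:
  assumes "finite_dim_subspace S" "\<And>z. z \<in> S \<Longrightarrow> cinner x z = 0" shows "proj S x = 0"
  using assms by (intro proj_unique)
    (auto simp: finite_dim_subspace_def complex_vector.subspace_0)

lemma proj_selfadjoint:
  assumes "finite_dim_subspace S" shows "cinner (proj S x) y = cinner x (proj S y)"
proof -
  have "cinner (proj S x) (y - proj S y) = 0"
    by (subst cinner_commute) (simp add: assms proj_in proj_residual_orthogonal)
  moreover have "cinner (x - proj S x) (proj S y) = 0"
    by (simp add: assms proj_in proj_residual_orthogonal)
  ultimately show ?thesis by (simp add: cinner_diff_left cinner_diff_right)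
qed

section \<open>Parseval's identity\<close>

text \<open>Among all vectors of the span of the first \<open>N\<close> basis vectors, the partial sum is the closest
  to \<open>x\<close>; density of the algebraic span therefore forces convergence.\<close>

lemma fourier_series_sums:
  assumes "orthonormal_basis e"
  shows "(\<lambda>n. scaleC (cinner x (e n)) (e n)) sums x"
proof -
  have on: "cinner (e i) (e j) = (if i = j then 1 else 0)" for i j
    using assms by (simp add: orthonormal_basis_def)
  have "inj e"
    by (rule injI) (metis on zero_neq_one)
  define s where "s N = (\<Sum>n<N. scaleC (cinner x (e n)) (e n))" for N
  have s: "s N = (\<Sum>f\<in>e ` {..<N}. scaleC (cinner x f) f)" for N
    unfolding s_def using inj_on_subset[OF \<open>inj e\<close>, of "{..<N}"] by (simp add: sum.reindex)
  have orthN: "orthonormal_set (e ` {..<N})" for N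
    unfolding orthonormal_set_def by (auto simp: on inj_eq[OF \<open>inj e\<close>])
  \<comment> \<open>Pythagoras, since the residual \<open>x - s N\<close> is orthogonal to \<open>v - s N\<close>.\<close>
  have best: "norm (s N - x) \<le> norm (v - x)" if v: "v \<in> cspan (e ` {..<N})" for v N
  proof -
    have "v - s N \<in> cspan (e ` {..<N})"
      using v unfolding s by (intro complex_vector.span_diff fourier_sum_in_span)
    then have "cinner (x - s N) (v - s N) = 0"
      using orthN unfolding s by (intro bessel_residual_orthogonal) simp_all
    then have "(norm ((x - s N) - (v - s N)))\<^sup>2 = (norm (x - s N))\<^sup>2 + (norm (v - s N))\<^sup>2"
      by (subst norm_diff_squared) simp
    then have "(norm (s N - x))\<^sup>2 \<le> (norm (v - x))\<^sup>2"
      by (simp add: norm_minus_commute)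
    then show ?thesis by (rule power2_le_imp_le) simp
  qed
  have "s \<longlonglongrightarrow> x"
  proof (rule metric_LIMSEQ_I)
    fix r :: real assume "r > 0"
    have "x \<in> closure (cspan (range e))" using assms by (simp add: orthonormal_basis_def)
    then obtain v where v: "v \<in> cspan (range e)" "dist v x < r"
      using \<open>r > 0\<close> unfolding closure_approachable by blast
    then obtain t c where t: "finite t" "t \<subseteq> range e" "v = (\<Sum>a\<in>t. scaleC (c a) a)"
      unfolding complex_vector.span_explicit by blast
    then obtain I where I: "finite I" "t = e ` I"
      using finite_subset_image[of t e UNIV] by auto
    obtain M where M: "I \<subseteq> {..<M}"
      using finite_nat_set_iff_bounded I(1) by (meson lessThan_iff subsetI)
    show "\<exists>M. \<forall>N\<ge>M. dist (s N) x < r"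
    proof (intro exI allI impI)
      fix N assume "N \<ge> M"
      then have "cspan t \<subseteq> cspan (e ` {..<N})"
        using M I by (intro complex_vector.span_mono) auto
      then have "v \<in> cspan (e ` {..<N})"
        using fourier_sum_in_span t(3) by blast
      then show "dist (s N) x < r"
        using best[of v N] v(2) by (simp add: dist_norm)
    qed
  qed
  then show ?thesis unfolding sums_def s_def .
qed

lemma parseval:
  assumes "orthonormal_basis e"
  shows "(\<lambda>n. cinner x (e n) * cinner (e n) y) sums cinner x y"
  using bounded_linear.sums[OF bounded_linear_cinner_left fourier_series_sums[OF assms], of x y]
  by (simp add: cinner_scaleC_left)

section \<open>Bounded complex-linear operators\<close>

lemma bounded_clinear_bounded_linear: "bounded_clinear T \<Longrightarrow> bounded_linear T"
  by (simp add: bounded_clinear_def)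

lemma bounded_clinear_scaleC: "bounded_clinear T \<Longrightarrow> T (scaleC a x) = scaleC a (T x)"
  by (simp add: bounded_clinear_def)

lemma bounded_clinear_compose:
  "bounded_clinear A \<Longrightarrow> bounded_clinear B \<Longrightarrow> bounded_clinear (A \<circ> B)"
  unfolding bounded_clinear_def comp_def by (simp add: bounded_linear_compose)

lemma bounded_clinear_add:
  "bounded_clinear A \<Longrightarrow> bounded_clinear B \<Longrightarrow> bounded_clinear (\<lambda>x. A x + B x)"
  unfolding bounded_clinear_def by (simp add: bounded_linear_add scaleC_add_right)

lemma bounded_clinear_diff:
  "bounded_clinear A \<Longrightarrow> bounded_clinear B \<Longrightarrow> bounded_clinear (\<lambda>x. A x - B x)"
  unfolding bounded_clinear_def
  by (simp add: bounded_linear_sub complex_vector.scale_right_diff_distrib)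

lemma bounded_clinear_scaleR:
  "bounded_clinear A \<Longrightarrow> bounded_clinear (\<lambda>x. scaleR r (A x))"
  unfolding bounded_clinear_def
  by (simp add: bounded_linear_const_scaleR) (simp add: scaleR_scaleC scaleC_scaleC mult.commute)

lemma bounded_clinear_rank_one: "bounded_clinear (rank_one f g)"
  unfolding bounded_clinear_def rank_one_def
  by (simp add: cinner_scaleC_left scaleC_scaleC
      bounded_linear_compose[OF bounded_linear_scaleC_left bounded_linear_cinner_left])

lemma bounded_clinear_proj:
  assumes "finite_dim_subspace S" shows "bounded_clinear (proj S)"
proof -
  obtain F where F: "finite F" "orthonormal_set F" "S = cspan F"
    using finite_dim_subspace_orthonormal[OF assms] .
  have P: "proj S = (\<lambda>x. \<Sum>f\<in>F. rank_one f f x)"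
    using F by (simp add: fun_eq_iff proj_cspan_orthonormal rank_one_def)
  show ?thesis
    unfolding bounded_clinear_def P
    by (simp add: bounded_linear_sum bounded_clinear_bounded_linear bounded_clinear_scaleC
        bounded_clinear_rank_one complex_vector.scale_sum_right)
qed

section \<open>Positive operators and their absolute value\<close>

lemma positive_op_bounded_clinear: "positive_op T \<Longrightarrow> bounded_clinear T"
  by (simp add: positive_op_def)

lemma positive_op_Re_ge_0: "positive_op T \<Longrightarrow> 0 \<le> Re (cinner (T x) x)"
  by (simp add: positive_op_def)

lemma positive_op_quadratic_real:
  "positive_op T \<Longrightarrow> cinner (T x) x = complex_of_real (Re (cinner (T x) x))"
  by (simp add: positive_op_def)

text \<open>Over the complex numbers a real quadratic form has a Hermitian polarization: testing on
  \<open>x + y\<close> and on \<open>x + \<i> y\<close> gives the imaginary and the real part.\<close>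

lemma positive_op_selfadjoint:
  assumes "positive_op T"
  shows "cinner (T x) y = cinner x (T y)"
proof -
  have lin: "linear T" "\<And>a x. T (scaleC a x) = scaleC a (T x)"
    using positive_op_bounded_clinear[OF assms]
    by (auto simp: bounded_clinear_def bounded_linear.linear)
  have real: "Im (cinner (T z) z) = 0" for z
    using assms by (simp add: positive_op_def complex_is_Real_iff)
  have "Im (cinner (T x) y) + Im (cinner (T y) x) = 0"
    using real[of "x + y"] real[of x] real[of y] by (simp add: linear_add[OF lin(1)] cinner_linear)
  moreover have "Re (cinner (T y) x) = Re (cinner (T x) y)"
    using real[of "x + scaleC \<i> y"] real[of x] real[of y]
    by (simp add: linear_add[OF lin(1)] lin(2) cinner_linear)
  ultimately have "cinner (T x) y = cnj (cinner (T y) x)"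
    by (simp add: complex_eq_iff)
  then show ?thesis by (metis cinner_commute)
qed

text \<open>This is \<open>T\<^sup>2 \<le> B T\<close>. The quadratic form of \<open>T\<close>
  is nonnegative at \<open>x - T x / B\<close>, where \<open>1 / B\<close> minimizes the resulting bound over the step
  length.\<close>

lemma positive_op_norm_squared_le:
  assumes "positive_op T" "0 < B" "\<And>x. norm (T x) \<le> B * norm x"
  shows "(norm (T x))\<^sup>2 \<le> B * Re (cinner (T x) x)"
proof -
  have lin: "linear T"
    using positive_op_bounded_clinear[OF assms(1)]
    by (simp add: bounded_clinear_def bounded_linear.linear)
  let ?y = "T x" and ?t = "1 / B"
  have "Re (cinner (T ?y) ?y) \<le> norm (T ?y) * norm ?y"
    using cauchy_schwarz[of "T ?y" ?y] complex_Re_le_cmod order_trans by blast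
  also have "\<dots> \<le> B * (norm ?y)\<^sup>2"
    using mult_right_mono[OF assms(3)[of ?y], of "norm ?y"] by (simp add: power2_eq_square mult_ac)
  finally have TT: "Re (cinner (T ?y) ?y) \<le> B * (norm ?y)\<^sup>2" .
  have "0 \<le> Re (cinner (T (x - ?t *\<^sub>R ?y)) (x - ?t *\<^sub>R ?y))"
    by (rule positive_op_Re_ge_0[OF assms(1)])
  also have "\<dots> = Re (cinner ?y x) - 2 * ?t * (norm ?y)\<^sup>2 + ?t\<^sup>2 * Re (cinner (T ?y) ?y)"
    by (simp add: linear_diff[OF lin] linear_scale[OF lin] cinner_linear
        positive_op_selfadjoint[OF assms(1), of ?y x] Re_cinner_self power2_eq_square
        right_diff_distrib del: of_real_divide)
  also have "\<dots> \<le> Re (cinner ?y x) - 2 * ?t * (norm ?y)\<^sup>2 + ?t\<^sup>2 * (B * (norm ?y)\<^sup>2)"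
    using mult_left_mono[OF TT, of "?t\<^sup>2"] by simp
  also have "\<dots> = Re (cinner ?y x) - (norm ?y)\<^sup>2 / B"
    using assms(2) by (simp add: power2_eq_square field_simps)
  finally show ?thesis using assms(2) by (simp add: field_simps)
qed

lemma positive_op_add:
  "positive_op A \<Longrightarrow> positive_op B \<Longrightarrow> positive_op (\<lambda>x. A x + B x)"
  unfolding positive_op_def by (simp add: bounded_clinear_add cinner_add_left)

lemma positive_op_scaleR:
  "positive_op A \<Longrightarrow> 0 \<le> r \<Longrightarrow> positive_op (\<lambda>x. scaleR r (A x))"
  unfolding positive_op_def
  by (simp add: bounded_clinear_scaleR cinner_scaleR_left)

lemma positive_op_rank_one: "positive_op (rank_one f f)"
proof -
  have "cinner (rank_one f f x) x = complex_of_real ((cmod (cinner x f))\<^sup>2)" for x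
    unfolding rank_one_def cinner_scaleC_left complex_norm_square
    by (subst (2) cinner_commute) simp
  then show ?thesis
    unfolding positive_op_def by (simp add: bounded_clinear_rank_one flip: of_real_power)
qed

lemma positive_op_compression:
  assumes "finite_dim_subspace S" "positive_op A"
  shows "positive_op (proj S \<circ> A \<circ> proj S)"
  using assms unfolding positive_op_def
  by (simp add: bounded_clinear_compose bounded_clinear_proj proj_selfadjoint)

text \<open>Let \<open>D = R - T\<close> and \<open>K = R + T\<close>. Although \<open>R\<close> and \<open>T\<close> are not known to commute,
  \<open>R\<^sup>2 = T\<^sup>2\<close> says exactly that \<open>K D = - D K\<close>. Hence
  \<open>\<langle>K x, D\<^sup>2 x\<rangle> = - \<langle>K D x, D x\<rangle> \<le> 0\<close>. If \<open>m = \<parallel>D\<parallel>\<close> were positive, a unit vector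
  \<open>x\<close> with \<open>\<parallel>D x\<parallel>\<close> close to \<open>m\<close> would nearly satisfy \<open>D\<^sup>2 x = m\<^sup>2 x\<close>, and the
  inequality would make \<open>\<langle>K x, x\<rangle>\<close> nearly zero. Then \<open>R x\<close> and \<open>T x\<close> are nearly zero, so
  \<open>D x\<close> is too, which is absurd. The proof makes this quantitative, so that it yields a bound on
  \<open>D\<close> strictly below its norm.\<close>

lemma positive_square_root_unique:
  assumes R: "positive_op R" and T: "positive_op T" and sq: "\<And>x. R (R x) = T (T x)"
  shows "R = T"
proof -
  have linR: "linear R" "bounded_linear R" and linT: "linear T" "bounded_linear T"
    using R T by (auto simp: positive_op_def bounded_clinear_def bounded_linear.linear)
  obtain B where B: "0 < B" "\<And>x. norm (R x) \<le> B * norm x" "\<And>x. norm (T x) \<le> B * norm x"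
  proof -
    obtain b c where "0 < b" "\<And>x. norm (R x) \<le> norm x * b" "0 < c" "\<And>x. norm (T x) \<le> norm x * c"
      using bounded_linear.pos_bounded linR(2) linT(2) by metis
    moreover have "norm x * b \<le> max b c * norm x" "norm x * c \<le> max b c * norm x" for x :: 'a
      by (simp_all only: mult.commute[of "norm x"] max.cobounded1 max.cobounded2 norm_ge_zero
          mult_right_mono)
    ultimately show thesis
      using that[of "max b c"] by (meson less_max_iff_disj order_trans)
  qed
  define D where "D x = R x - T x" for x
  define K where "K x = R x + T x" for x
  have D: "bounded_linear D"
    unfolding D_def using linR linT by (intro bounded_linear_sub)
  have D_sa: "cinner (D x) y = cinner x (D y)" for x y
    by (simp add: D_def cinner_linear positive_op_selfadjoint[OF R] positive_op_selfadjoint[OF T])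
  have K: "positive_op K"
    unfolding K_def by (rule positive_op_add[OF R T])
  have K_bound: "norm (K x) \<le> 2 * B * norm x" for x
    using norm_triangle_ineq[of "R x" "T x"] B(2,3)[of x] by (simp add: K_def)
  define q where "q x = Re (cinner (K x) x)" for x
  have q0: "0 \<le> q x" for x
    unfolding q_def by (rule positive_op_Re_ge_0[OF K])
  define m where "m = onorm D"
  have m: "norm (D x) \<le> m * norm x" for x
    unfolding m_def by (rule onorm[OF D])
  have m0: "0 \<le> m" unfolding m_def by (rule onorm_pos_le[OF D])
  have sylvester: "K (D x) = - D (K x)" for x
    by (simp add: K_def D_def linear_diff[OF linR(1)] linear_diff[OF linT(1)]
        linear_add[OF linR(1)] linear_add[OF linT(1)] sq)
  have neg: "Re (cinner (K x) (D (D x))) \<le> 0" for x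
  proof -
    have "cinner (K x) (D (D x)) = cinner (D (K x)) (D x)"
      by (simp only: D_sa)
    also have "\<dots> = - cinner (K (D x)) (D x)"
      by (simp add: sylvester cinner_minus_left)
    finally have "cinner (K x) (D (D x)) = - cinner (K (D x)) (D x)" .
    then show ?thesis using q0[of "D x"] by (simp add: q_def)
  qed
  \<comment> \<open>If \<open>\<langle>K x, x\<rangle>\<close> is small, so are \<open>R x\<close> and \<open>T x\<close>, each form being at most that of \<open>K\<close>.\<close>
  have Dq: "(norm (D x))\<^sup>2 \<le> 2 * B * q x" for x
  proof -
    have "(norm (D x))\<^sup>2 \<le> (norm (R x) + norm (T x))\<^sup>2"
      unfolding D_def by (simp add: norm_triangle_ineq4 power_mono)
    also have "\<dots> \<le> 2 * (norm (R x))\<^sup>2 + 2 * (norm (T x))\<^sup>2"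
      using sum_squares_bound[of "norm (R x)" "norm (T x)"] by (simp add: power2_sum)
    also have "\<dots> \<le> 2 * (B * Re (cinner (R x) x)) + 2 * (B * Re (cinner (T x) x))"
      using positive_op_norm_squared_le[OF R B(1,2), of x]
        positive_op_norm_squared_le[OF T B(1,3), of x] by simp
    also have "\<dots> = 2 * B * q x"
      by (simp add: q_def K_def cinner_linear algebra_simps)
    finally show ?thesis .
  qed
  \<comment> \<open>The vector \<open>w\<close> measures how far \<open>x\<close> is from being an eigenvector of \<open>D\<^sup>2\<close> for \<open>m\<^sup>2\<close>.\<close>
  have qm: "m\<^sup>2 * q x \<le> 2 * B * (m\<^sup>2 * (norm x)\<^sup>2 - (norm (D x))\<^sup>2)" if "m > 0" for x
  proof -
    define w where "w = m\<^sup>2 *\<^sub>R x - D (D x)"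
    have "Re (cinner x (D (D x))) = (norm (D x))\<^sup>2"
      by (metis D_sa Re_cinner_self)
    then have "(norm w)\<^sup>2 = m^4 * (norm x)\<^sup>2 - 2 * m\<^sup>2 * (norm (D x))\<^sup>2 + (norm (D (D x)))\<^sup>2"
      unfolding w_def norm_diff_squared
      by (simp add: cinner_scaleR_left power_mult_distrib)
    also have "(norm (D (D x)))\<^sup>2 \<le> m\<^sup>2 * (norm (D x))\<^sup>2"
      using power_mono[OF m[of "D x"], of 2] by (simp add: power_mult_distrib)
    finally have w: "(norm w)\<^sup>2 \<le> m\<^sup>2 * (m\<^sup>2 * (norm x)\<^sup>2 - (norm (D x))\<^sup>2)"
      by (simp add: algebra_simps flip: power_add)
    have "m\<^sup>2 * q x \<le> Re (cinner (K x) w)"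
      using neg[of x] by (simp add: w_def q_def cinner_linear)
    also have "\<dots> \<le> norm (K x) * norm w"
      using cauchy_schwarz[of "K x" w] complex_Re_le_cmod order_trans by blast
    finally have "(m\<^sup>2 * q x)\<^sup>2 \<le> (norm (K x))\<^sup>2 * (norm w)\<^sup>2"
      using q0[of x] by (simp add: power_mono flip: power_mult_distrib)
    also have "\<dots> \<le> (2 * B * q x) * (m\<^sup>2 * (m\<^sup>2 * (norm x)\<^sup>2 - (norm (D x))\<^sup>2))"
      using positive_op_norm_squared_le[OF K _ K_bound, of x] B(1) w q0[of x]
      by (intro mult_mono) (simp_all add: q_def)
    finally have *: "(m\<^sup>2 * q x) * (m\<^sup>2 * q x)
        \<le> (m\<^sup>2 * q x) * (2 * B * (m\<^sup>2 * (norm x)\<^sup>2 - (norm (D x))\<^sup>2))"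
      by (simp add: power2_eq_square mult_ac)
    have r: "0 \<le> m\<^sup>2 * (norm x)\<^sup>2 - (norm (D x))\<^sup>2"
      using power_mono[OF m[of x], of 2] by (simp add: power_mult_distrib)
    show ?thesis
    proof (cases "q x = 0")
      case True then show ?thesis using r B(1) by simp
    next
      case False
      then have "0 < m\<^sup>2 * q x" using q0[of x] that by simp
      then show ?thesis using * mult_le_cancel_left_pos by blast
    qed
  qed
  have "m = 0"
  proof (rule ccontr)
    assume "m \<noteq> 0"
    then have mpos: "m > 0" using m0 by simp
    \<comment> \<open>Combining the last two estimates bounds \<open>m\<^sup>2 \<parallel>D x\<parallel>\<^sup>2\<close> by \<open>4 B\<^sup>2\<close> times
      \<open>m\<^sup>2 \<parallel>x\<parallel>\<^sup>2 - \<parallel>D x\<parallel>\<^sup>2\<close>; solving for \<open>\<parallel>D x\<parallel>\<close> gains a factor below 1.\<close>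
    define c where "c = 4 * B\<^sup>2"
    have c: "c > 0" using B(1) by (simp add: c_def)
    have "norm (D x) \<le> sqrt (c / (m\<^sup>2 + c)) * m * norm x" for x
    proof -
      have "m\<^sup>2 * (norm (D x))\<^sup>2 \<le> 2 * B * (m\<^sup>2 * q x)"
        using mult_left_mono[OF Dq[of x], of "m\<^sup>2"] by (simp add: mult_ac)
      also have "\<dots> \<le> c * (m\<^sup>2 * (norm x)\<^sup>2 - (norm (D x))\<^sup>2)"
        using mult_left_mono[OF qm[OF mpos, of x], of "2 * B"] B(1)
        by (simp add: c_def power2_eq_square mult_ac)
      finally have "(m\<^sup>2 + c) * (norm (D x))\<^sup>2 \<le> c * (m\<^sup>2 * (norm x)\<^sup>2)"
        by (simp add: algebra_simps)
      then have "(norm (D x))\<^sup>2 \<le> c / (m\<^sup>2 + c) * (m\<^sup>2 * (norm x)\<^sup>2)"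
        using c by (simp add: pos_le_divide_eq add_nonneg_pos mult_ac)
      also have "\<dots> = (sqrt (c / (m\<^sup>2 + c)) * m * norm x)\<^sup>2"
        using c by (simp add: power_mult_distrib)
      finally show ?thesis
        by (rule power2_le_imp_le) (use c m0 in simp)
    qed
    then have "m \<le> sqrt (c / (m\<^sup>2 + c)) * m"
      using c m0 unfolding m_def by (intro onorm_bound) simp_all
    then have "1 \<le> sqrt (c / (m\<^sup>2 + c))" using mpos by simp
    moreover have "c / (m\<^sup>2 + c) < 1" using c mpos by (simp add: add_pos_pos)
    ultimately show False by simp
  qed
  then have "D x = 0" for x using m[of x] by simp
  then show ?thesis by (auto simp: D_def fun_eq_iff)
qed

lemma cadjoint_positive:
  assumes "positive_op T" shows "cadjoint T = T"
  unfolding cadjoint_def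
proof (rule the_equality)
  fix T' assume T': "\<forall>x y. cinner (T x) y = cinner x (T' y)"
  show "T' = T"
  proof
    fix y show "T' y = T y"
    proof (rule cinner_ext)
      fix z
      have "cinner z (T' y) = cinner z (T y)"
        using T' positive_op_selfadjoint[OF assms] by metis
      then show "cinner (T' y) z = cinner (T y) z"
        by (metis cinner_commute)
    qed
  qed
qed (simp add: positive_op_selfadjoint[OF assms])

lemma abs_op_positive:
  assumes "positive_op T" shows "abs_op T = T"
  unfolding abs_op_def cadjoint_positive[OF assms]
proof (rule the_equality)
  fix R assume "positive_op R \<and> R \<circ> R = T \<circ> T"
  then show "R = T"
    by (intro positive_square_root_unique assms) (auto dest: comp_eq_dest)
qed (simp add: assms)

lemma trace_class_positive_iff:
  assumes "positive_op T"
  shows "trace_class e T \<longleftrightarrow> summable (\<lambda>n. cinner (T (e n)) (e n))"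
  by (simp add: trace_class_def abs_op_positive[OF assms] positive_op_bounded_clinear[OF assms])

section \<open>Traces of compressions\<close>

text \<open>The trace of \<open>T P\<close> for a finite-rank projection \<open>P\<close> may be computed on an orthonormal basis of
  the range: each \<open>T f\<close> contributes one Parseval series, and a finite sum of series may be taken
  termwise.\<close>

lemma trace_restricted_to_range:
  assumes "orthonormal_basis e" "finite F" "orthonormal_set F" "bounded_clinear T"
  shows "(\<lambda>n. cinner (T (proj (cspan F) (e n))) (e n)) sums (\<Sum>f\<in>F. cinner (T f) f)"
proof -
  have lin: "linear T" "\<And>a x. T (scaleC a x) = scaleC a (T x)"
    using assms(4) by (auto simp: bounded_clinear_def bounded_linear.linear)
  have "cinner (T (proj (cspan F) (e n))) (e n)
      = (\<Sum>f\<in>F. cinner (T f) (e n) * cinner (e n) f)" for n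
    by (simp add: proj_cspan_orthonormal[OF assms(2,3)] linear_sum[OF lin(1)] lin(2)
        cinner_sum_left cinner_scaleC_left mult.commute)
  then show ?thesis
    by (simp add: sums_sum parseval[OF assms(1)])
qed

text \<open>With \<open>v = P e\<^sub>j\<close> the operator \<open>P E\<^sub>j P\<close> is \<open>v \<otimes> v\<close>, so this trace is a single
  Parseval series; likewise for the product in the opposite order.\<close>

lemma op_trace_compression_right:
  assumes "orthonormal_basis e" "finite_dim_subspace S" "bounded_clinear T"
  shows "op_trace e (T \<circ> compressions e S j) = cinner (T (proj S (e j))) (proj S (e j))"
proof -
  let ?v = "proj S (e j)"
  have "cinner ((T \<circ> compressions e S j) (e n)) (e n) = cinner (T ?v) (e n) * cinner (e n) ?v" for n
    by (simp add: compressions_def rank_one_def cinner_scaleC_left proj_selfadjoint[OF assms(2)]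
        bounded_clinear_scaleC[OF bounded_clinear_proj[OF assms(2)]]
        bounded_clinear_scaleC[OF assms(3)])
  then show ?thesis
    unfolding op_trace_def using sums_unique[OF parseval[OF assms(1), of "T ?v" ?v]] by simp
qed

lemma op_trace_compression_left:
  assumes "orthonormal_basis e" "finite_dim_subspace S" "positive_op \<rho>"
  shows "op_trace e (compressions e S j \<circ> \<rho>) = cinner (\<rho> (proj S (e j))) (proj S (e j))"
proof -
  let ?v = "proj S (e j)"
  have "cinner ((compressions e S j \<circ> \<rho>) (e n)) (e n) = cinner ?v (e n) * cinner (e n) (\<rho> ?v)" for n
    by (simp add: compressions_def rank_one_def cinner_scaleC_left proj_selfadjoint[OF assms(2)]
        bounded_clinear_scaleC[OF bounded_clinear_proj[OF assms(2)]]
        positive_op_selfadjoint[OF assms(3)])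
  then show ?thesis
    unfolding op_trace_def
    using sums_unique[OF parseval[OF assms(1), of ?v "\<rho> ?v"]]
    by (simp add: positive_op_selfadjoint[OF assms(3)])
qed

text \<open>Compressing a positive operator does not increase its trace: the block \<open>Q \<rho> Q\<close> contributes
  nonnegative terms, and the off-diagonal block \<open>Q \<rho> P\<close> has trace zero.\<close>

lemma trace_compression_le:
  assumes e: "orthonormal_basis e" and S: "finite_dim_subspace S"
    and \<rho>: "positive_op \<rho>" "trace_class e \<rho>"
  obtains t where "0 \<le> t" "t \<le> Re (op_trace e \<rho>)"
    "(\<lambda>n. cinner ((proj S \<circ> \<rho> \<circ> proj S) (e n)) (e n)) sums complex_of_real t"
proof -
  obtain F where F: "finite F" "orthonormal_set F" "S = cspan F"
    using finite_dim_subspace_orthonormal[OF S] .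
  note b\<rho> = positive_op_bounded_clinear[OF \<rho>(1)] and bP = bounded_clinear_proj[OF S]
  have lin: "linear \<rho>"
    using b\<rho> by (simp add: bounded_clinear_def bounded_linear.linear)
  have Pf: "proj S f = f" if "f \<in> F" for f
    using that F(3) by (intro proj_fixes[OF S]) (simp add: complex_vector.span_base)
  define t where "t = (\<Sum>f\<in>F. Re (cinner (\<rho> f) f))"
  have t: "(\<Sum>f\<in>F. cinner ((proj S \<circ> \<rho>) f) f) = complex_of_real t"
    unfolding t_def of_real_sum
    by (intro sum.cong refl)
       (simp add: proj_selfadjoint[OF S] Pf positive_op_quadratic_real[OF \<rho>(1), symmetric])
  have diag: "(\<lambda>n. cinner ((proj S \<circ> \<rho> \<circ> proj S) (e n)) (e n)) sums complex_of_real t"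
    using trace_restricted_to_range[OF e F(1,2) bounded_clinear_compose[OF bP b\<rho>]]
    unfolding t F(3)[symmetric] by simp
  \<comment> \<open>\<open>C = Q \<rho>\<close>, whose values are orthogonal to \<open>S\<close>, so that \<open>C P\<close> is the off-diagonal block.\<close>
  define C where "C x = \<rho> x - proj S (\<rho> x)" for x
  have "bounded_clinear C"
    using bounded_clinear_diff[OF b\<rho> bounded_clinear_compose[OF bP b\<rho>]]
    unfolding C_def comp_def .
  moreover have "cinner (C f) f = 0" if "f \<in> F" for f
    by (simp add: C_def cinner_diff_left proj_selfadjoint[OF S] Pf[OF that])
  ultimately have off_diag: "(\<lambda>n. cinner (C (proj S (e n))) (e n)) sums 0"
    using trace_restricted_to_range[OF e F(1,2), of C] F(3) by simp
  have split: "Re (cinner (proj S (\<rho> (proj S x))) x) + 2 * Re (cinner (C (proj S x)) x)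
      \<le> Re (cinner (\<rho> x) x)" for x
  proof -
    define p where "p = proj S x"
    define q where "q = x - p"
    have "x = p + q" by (simp add: q_def)
    then have "cinner (\<rho> x) x
        = cinner (\<rho> p) p + cinner (\<rho> p) q + cinner (\<rho> q) p + cinner (\<rho> q) q"
      by (simp add: linear_add[OF lin] cinner_add_left cinner_add_right)
    moreover have "Re (cinner (\<rho> q) p) = Re (cinner (\<rho> p) q)"
      unfolding positive_op_selfadjoint[OF \<rho>(1)] by (subst cinner_commute)
        (simp add: positive_op_selfadjoint[OF \<rho>(1)])
    moreover have "cinner (C p) x = cinner (\<rho> p) q"
      by (simp add: C_def q_def p_def cinner_diff_left cinner_diff_right proj_selfadjoint[OF S])
    moreover have "cinner (proj S (\<rho> p)) x = cinner (\<rho> p) p"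
      by (simp add: p_def proj_selfadjoint[OF S])
    ultimately show ?thesis
      using positive_op_Re_ge_0[OF \<rho>(1), of q] by (simp add: p_def)
  qed
  have "(\<lambda>n. Re (cinner (proj S (\<rho> (proj S (e n)))) (e n)) + 2 * Re (cinner (C (proj S (e n))) (e n)))
      sums (t + 2 * 0)"
    using sums_Re[OF diag] sums_Re[OF off_diag] by (intro sums_add sums_mult) simp_all
  moreover have "(\<lambda>n. Re (cinner (\<rho> (e n)) (e n))) sums Re (op_trace e \<rho>)"
    using \<rho> unfolding op_trace_def
    by (intro sums_Re summable_sums) (simp add: trace_class_positive_iff)
  ultimately have "t \<le> Re (op_trace e \<rho>)"
    using sums_le[OF split] by fastforce
  moreover have "0 \<le> t"
    unfolding t_def by (intro sum_nonneg positive_op_Re_ge_0[OF \<rho>(1)])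
  ultimately show thesis using diag that by blast
qed

lemma rank_one_trace_sums:
  assumes "orthonormal_basis e" "norm f = 1"
  shows "(\<lambda>n. cinner (rank_one f f (e n)) (e n)) sums 1"
  using parseval[OF assms(1), of f f] assms(2)
  by (simp add: rank_one_def cinner_scaleC_left mult.commute cinner_self)

text \<open>If \<open>P\<close> fixed every basis vector, the series \<open>\<Sum> \<langle>P e\<^sub>n, e\<^sub>n\<rangle>\<close> would have all terms
  equal to 1 and yet converge to the dimension of \<open>S\<close>.\<close>

lemma unit_vector_orthogonal:
  fixes e :: "nat \<Rightarrow> 'a::complex_hilbert" and S :: "'a set"
  assumes e: "orthonormal_basis e" and S: "finite_dim_subspace S"
  obtains g where "norm g = 1" "proj S g = 0"
proof -
  obtain F where F: "finite F" "orthonormal_set F" "S = cspan F"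
    using finite_dim_subspace_orthonormal[OF S] .
  have "\<exists>n. proj S (e n) \<noteq> e n"
  proof (rule ccontr)
    assume "\<not> ?thesis"
    then have "(\<lambda>n. cinner (e n) (e n)) sums (\<Sum>f\<in>F. cinner f f)"
      using trace_restricted_to_range[OF e F(1,2), of id] F(3)
      by (simp add: bounded_clinear_def bounded_linear_ident id_def)
    then have "summable (\<lambda>n. 1 :: complex)"
      using e by (auto simp: orthonormal_basis_def summable_def)
    then show False by (simp add: summable_const_iff)
  qed
  then obtain n where n: "proj S (e n) \<noteq> e n" ..
  define r where "r = e n - proj S (e n)"
  define g where "g = scaleR (inverse (norm r)) r"
  have "norm r \<noteq> 0" using n by (simp add: r_def)
  then have "norm g = 1" by (simp add: g_def)
  moreover have "proj S g = 0"
    by (rule proj_orthogonal_eq_zero[OF S])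
       (simp add: g_def r_def cinner_scaleR_left proj_residual_orthogonal[OF S])
  ultimately show thesis by (rule that)
qed

lemma density_opsI:
  assumes "positive_op Y" "\<And>x. proj S (Y x) = Y x"
    "(\<lambda>n. cinner (Y (e n)) (e n)) sums 1"
  shows "Y \<in> density_ops e S"
  using assms unfolding density_ops_def op_trace_def
  by (simp add: trace_class_positive_iff sums_iff comp_def)

text \<open>Since \<open>P Y = Y\<close> and both operators are self-adjoint, also \<open>Y P = Y\<close>; hence compression does
  not change the diagonal of \<open>Y\<close>.\<close>

lemma density_ops_compression:
  assumes S: "finite_dim_subspace S" and Y: "Y \<in> density_ops e S"
  shows "cinner (Y (proj S x)) (proj S x) = cinner (Y x) x"
proof -
  have P: "proj S (Y z) = Y z" for z
    using Y by (auto simp: density_ops_def fun_eq_iff)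
  have sa: "positive_op Y" using Y by (simp add: density_ops_def)
  have "cinner (Y (proj S x)) (proj S x) = cinner (Y (proj S x)) x"
    by (simp add: proj_selfadjoint[OF S, symmetric] P)
  also have "\<dots> = cinner (proj S x) (Y x)"
    by (rule positive_op_selfadjoint[OF sa])
  also have "\<dots> = cinner x (Y x)"
    by (simp add: proj_selfadjoint[OF S] P)
  finally show ?thesis by (simp add: positive_op_selfadjoint[OF sa])
qed

lemma moment_set_nonempty:
  assumes e: "orthonormal_basis e" and S: "finite_dim_subspace S" "S \<noteq> {0}"
  obtains x where "x \<in> moment_set e S"
proof -
  have sub: "csubspace S" using S by (simp add: finite_dim_subspace_def)
  then obtain v where v: "v \<in> S" "v \<noteq> 0"
    using S(2) complex_vector.subspace_0[OF sub] by auto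
  define f where "f = scaleC (complex_of_real (inverse (norm v))) v"
  have f: "f \<in> S" "norm f = 1"
    using v by (simp_all add: f_def norm_scaleC norm_inverse complex_vector.subspace_scale[OF sub])
  have "rank_one f f \<in> density_ops e S"
  proof (rule density_opsI[OF positive_op_rank_one _ rank_one_trace_sums[OF e f(2)]])
    show "proj S (rank_one f f x) = rank_one f f x" for x
      unfolding rank_one_def
      by (rule proj_fixes[OF S(1)]) (rule complex_vector.subspace_scale[OF sub f(1)])
  qed
  then show thesis using that unfolding moment_set_def by blast
qed

section \<open>The joint numerical range\<close>

text \<open>A sequence of the range is the diagonal of a compression \<open>P \<rho> P\<close>, and the scalar \<open>t\<close> is the
  trace of that compression, the weight that \<open>\<rho>\<close> gives to \<open>S\<close>.\<close>

lemma joint_numerical_range_compressions: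
  fixes e :: "nat \<Rightarrow> 'a::complex_hilbert"
  assumes e: "orthonormal_basis e" and S: "finite_dim_subspace S" "S \<noteq> {0}"
  shows "joint_numerical_range e (compressions e S)
    = {(\<lambda>j. complex_of_real t * x j) | t x. 0 \<le> t \<and> t \<le> 1 \<and> x \<in> moment_set e S}"
    (is "?W = ?M")
proof
  show "?W \<subseteq> ?M"
  proof
    fix w assume "w \<in> ?W"
    then obtain \<rho> where \<rho>: "trace_class e \<rho>" "positive_op \<rho>" "op_trace e \<rho> = 1"
      and "w = (\<lambda>j. op_trace e (compressions e S j \<circ> \<rho>))"
      unfolding joint_numerical_range_def by blast
    define Z where "Z = proj S \<circ> \<rho> \<circ> proj S"
    have w: "w = (\<lambda>j. cinner (Z (e j)) (e j))"
      unfolding \<open>w = _\<close>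
      by (simp add: Z_def op_trace_compression_left[OF e S(1) \<rho>(2)] proj_selfadjoint[OF S(1)])
    have Z: "positive_op Z"
      unfolding Z_def by (rule positive_op_compression[OF S(1) \<rho>(2)])
    obtain t where t: "0 \<le> t" "t \<le> 1"
      and Zt: "(\<lambda>n. cinner (Z (e n)) (e n)) sums complex_of_real t"
      using trace_compression_le[OF e S(1) \<rho>(2,1)] \<rho>(3) unfolding Z_def by (metis one_complex.sel(1))
    have "\<exists>x\<in>moment_set e S. w = (\<lambda>j. complex_of_real t * x j)"
    proof (cases "t = 0")
      case True
      have "(\<lambda>n. Re (cinner (Z (e n)) (e n))) sums 0"
        using sums_Re[OF Zt] True by simp
      then have "Re (cinner (Z (e n)) (e n)) = 0" for n
        using suminf_eq_zero_iff[of "\<lambda>n. Re (cinner (Z (e n)) (e n))"] positive_op_Re_ge_0[OF Z]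
        by (simp add: sums_iff)
      then have "w = (\<lambda>j. complex_of_real t * x j)" for x :: "nat \<Rightarrow> complex"
        unfolding w using True positive_op_quadratic_real[OF Z] by (metis mult_zero_left of_real_0)
      then show ?thesis using moment_set_nonempty[OF e S] by metis
    next
      case False
      define Y where "Y x = scaleR (1 / t) (Z x)" for x
      have "Y \<in> density_ops e S"
      proof (rule density_opsI)
        show "positive_op Y"
          unfolding Y_def using Z t by (intro positive_op_scaleR) simp_all
        have "Y x \<in> S" for x
          unfolding Y_def scaleR_scaleC using S(1)
          by (intro complex_vector.subspace_scale)
             (simp_all add: Z_def finite_dim_subspace_def proj_in[OF S(1)])
        then show "proj S (Y x) = Y x" for x
          by (rule proj_fixes[OF S(1)])
        show "(\<lambda>n. cinner (Y (e n)) (e n)) sums 1"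
          using sums_mult[OF Zt, of "complex_of_real (1 / t)"] False
          by (simp add: Y_def cinner_scaleR_left)
      qed
      then have "(\<lambda>j. cinner (Y (e j)) (e j)) \<in> moment_set e S"
        unfolding moment_set_def by blast
      moreover have "w = (\<lambda>j. complex_of_real t * cinner (Y (e j)) (e j))"
        using False by (simp add: w Y_def cinner_scaleR_left)
      ultimately show ?thesis by (intro bexI[of _ "\<lambda>j. cinner (Y (e j)) (e j)"])
    qed
    then obtain x where "x \<in> moment_set e S" "w = (\<lambda>j. complex_of_real t * x j)" ..
    then show "w \<in> ?M"
      using t by (intro CollectI exI[of _ t] exI[of _ x]) simp
  qed
next
  show "?M \<subseteq> ?W"
  proof
    fix w assume "w \<in> ?M"
    then obtain t Y where t: "0 \<le> t" "t \<le> 1" and Y: "Y \<in> density_ops e S"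
      and w: "w = (\<lambda>j. complex_of_real t * cinner (Y (e j)) (e j))"
      unfolding moment_set_def by blast
    obtain g where g: "norm g = 1" "proj S g = 0"
      using unit_vector_orthogonal[OF e S(1)] .
    \<comment> \<open>The remaining weight \<open>1 - t\<close> goes to \<open>g\<close>, which the projection annihilates.\<close>
    define \<rho> where "\<rho> x = scaleR t (Y x) + scaleR (1 - t) (rank_one g g x)" for x
    have Y': "positive_op Y" "(\<lambda>n. cinner (Y (e n)) (e n)) sums 1"
      using Y by (auto simp: density_ops_def op_trace_def trace_class_positive_iff sums_iff)
    have pos: "positive_op \<rho>"
      unfolding \<rho>_def using t Y'(1)
      by (intro positive_op_add positive_op_scaleR positive_op_rank_one) simp_all
    have "(\<lambda>n. complex_of_real t * cinner (Y (e n)) (e n)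
          + complex_of_real (1 - t) * cinner (rank_one g g (e n)) (e n))
        sums (complex_of_real t * 1 + complex_of_real (1 - t) * 1)"
      by (intro sums_add sums_mult Y'(2) rank_one_trace_sums[OF e g(1)])
    then have "(\<lambda>n. cinner (\<rho> (e n)) (e n)) sums 1"
      by (simp add: \<rho>_def cinner_add_left cinner_scaleR_left)
    then have tr: "trace_class e \<rho>" "op_trace e \<rho> = 1"
      by (simp_all add: trace_class_positive_iff[OF pos] op_trace_def sums_iff)
    have "op_trace e (compressions e S j \<circ> \<rho>) = w j" for j
    proof -
      have "cinner (proj S (e j)) g = 0"
        by (simp add: proj_selfadjoint[OF S(1)] g(2))
      then show ?thesis
        by (simp add: op_trace_compression_left[OF e S(1) pos] \<rho>_def rank_one_def w
            cinner_add_left cinner_scaleR_left density_ops_compression[OF S(1) Y])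
    qed
    then have "w = (\<lambda>j. op_trace e (compressions e S j \<circ> \<rho>))" by auto
    then show "w \<in> ?W"
      using pos tr unfolding joint_numerical_range_def by blast
  qed
qed

theorem proposition3:
  fixes e :: "nat \<Rightarrow> 'a::complex_hilbert" and S :: "'a set"
  assumes "orthonormal_basis e"
    and "finite_dim_subspace S" and "S \<noteq> {0}"
  shows "joint_numerical_range e (compressions e S)
           = {(\<lambda>j. complex_of_real t * x j) | t x. 0 \<le> t \<and> t \<le> 1 \<and> x \<in> moment_set e S}
       \<and> {(\<lambda>j. complex_of_real t * x j) | t x. 0 \<le> t \<and> t \<le> 1 \<and> x \<in> moment_set e S}
           = (\<Union>t\<in>{0..1}. {(\<lambda>j. complex_of_real t * op_trace e (\<mu> \<circ> compressions e S j)) | \<mu>.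
                              \<mu> \<in> density_ops e S})
       \<and> cone_of (joint_numerical_range e (compressions e S)) = cone_of (moment_set e S)"
proof (intro conjI)
  let ?W = "joint_numerical_range e (compressions e S)"
  let ?M = "{(\<lambda>j. complex_of_real t * x j) | t x. 0 \<le> t \<and> t \<le> 1 \<and> x \<in> moment_set e S}"
  show W: "?W = ?M"
    by (rule joint_numerical_range_compressions[OF assms])
  have moment: "op_trace e (\<mu> \<circ> compressions e S j) = cinner (\<mu> (e j)) (e j)"
    if "\<mu> \<in> density_ops e S" for \<mu> j
    using that op_trace_compression_right[OF assms(1,2)] density_ops_compression[OF assms(2) that]
    by (simp add: density_ops_def positive_op_bounded_clinear)
  show "?M = (\<Union>t\<in>{0..1}. {(\<lambda>j. complex_of_real t * op_trace e (\<mu> \<circ> compressions e S j)) | \<mu>.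
                              \<mu> \<in> density_ops e S})" (is "_ = ?U")
  proof
    show "?M \<subseteq> ?U"
    proof
      fix w assume "w \<in> ?M"
      then obtain t Y where "0 \<le> t" "t \<le> 1" "Y \<in> density_ops e S"
        "w = (\<lambda>j. complex_of_real t * cinner (Y (e j)) (e j))"
        unfolding moment_set_def by blast
      then have "t \<in> {0..1}"
        "w = (\<lambda>j. complex_of_real t * op_trace e (Y \<circ> compressions e S j))"
        by (simp_all add: moment)
      then show "w \<in> ?U" using \<open>Y \<in> density_ops e S\<close> by blast
    qed
    show "?U \<subseteq> ?M"
    proof
      fix w assume "w \<in> ?U"
      then obtain t Y where "t \<in> {0..1}" "Y \<in> density_ops e S"
        "w = (\<lambda>j. complex_of_real t * op_trace e (Y \<circ> compressions e S j))"
        by blast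
      then have "0 \<le> t" "t \<le> 1" "w = (\<lambda>j. complex_of_real t * cinner (Y (e j)) (e j))"
        "(\<lambda>j. cinner (Y (e j)) (e j)) \<in> moment_set e S"
        by (auto simp: moment moment_set_def)
      then show "w \<in> ?M"
        by (intro CollectI exI[of _ t] exI[of _ "\<lambda>j. cinner (Y (e j)) (e j)"]) simp
    qed
  qed
  show "cone_of ?W = cone_of (moment_set e S)"
  proof
    show "cone_of ?W \<subseteq> cone_of (moment_set e S)"
    proof
      fix w assume "w \<in> cone_of ?W"
      then obtain l t x where "0 \<le> l" "0 \<le> t" "x \<in> moment_set e S"
        "w = (\<lambda>j. complex_of_real l * (complex_of_real t * x j))"
        unfolding W cone_of_def by blast
      then have "0 \<le> l * t" "x \<in> moment_set e S" "w = (\<lambda>j. complex_of_real (l * t) * x j)"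
        by (simp_all add: mult.assoc)
      then show "w \<in> cone_of (moment_set e S)"
        unfolding cone_of_def by (intro CollectI exI[of _ "l * t"] exI[of _ x]) simp
    qed
    have "moment_set e S \<subseteq> ?W"
    proof
      fix x assume "x \<in> moment_set e S"
      then show "x \<in> ?W"
        unfolding W by (intro CollectI exI[of _ 1] exI[of _ x]) simp
    qed
    then show "cone_of (moment_set e S) \<subseteq> cone_of ?W"
      unfolding cone_of_def by blast
  qed
qed

end
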